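(* Consider an affiliation random graph mixture model with $Q\ge 2$ groups (either the binary one or the weighted one), with all parameters other than $\boldsymbol\pi$ held fixed. If $n<Q$, then the group proportions are not identifiable up to label swapping from the joint distribution of $K_n$: there exist $\boldsymbol\pi,\boldsymbol\pi'$ in the open simplex, with $\boldsymbol\pi'$ not a permutation of $\boldsymbol\pi$, which induce the same joint law of $K_n$. Equivalently, identifiability of $\boldsymbol\pi$ up to label swapping from the law of $K_n$ requires $n\ge Q$.
   Context: Random graph mixture model: nodes have i.i.d. latent groups $Z_i\in\{1,\dots,Q\}$ with $\pi_q=\mathbb P(Z_i=q)\in(0,1)$, $\sum_q\pi_q=1$; edge variables $X_{ij}$ ($i<j$) are conditionally independent given all $Z$'s, with law of $X_{ij}$ depending only on $(Z_i,Z_j)$. Binary affiliation model: $X_{ij}\in\{0,1\}$, $\mathbb P(X_{ij}=1\mid Z_i=q,Z_j=l)=\alpha$ if $q=l$, $\beta$ if $q\ne l$. Weighted affiliation model: the conditional law of $X_{ij}$ given $Z_i=q,Z_j=l$ is $\mu_{\rm in}$ if $q=l$ and $\mu_{\rm out}$ if $q\ne l$, where $\mu_{\rm in},\mu_{\rm out}$ are probability measures on $\mathbb N$, $\mathbb R$ or $\mathbb R^s$ (e.g. $\mu=(1-p)\delta_0+pF$ with $F$ having no atom at $0$). $K_n$ denotes the collection of the $\binom n2$ edge variables among a set of $n$ nodes. *)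

theory Defs
  imports "HOL-Probability.Probability"
begin

definition edges :: "nat \<Rightarrow> (nat \<times> nat) set" where
  "edges n = {(i, j). i < j \<and> j < n}"

definition open_simplex :: "nat \<Rightarrow> nat pmf \<Rightarrow> bool" where
  "open_simplex Q p \<longleftrightarrow> set_pmf p \<subseteq> {..<Q} \<and> (\<forall>q<Q. pmf p q > 0)"

text \<open>Joint law of K_n in the (weighted) affiliation model: latent groups Z_i i.i.d. with law p,
  edges conditionally independent given Z, X_ij ~ mu_in if Z_i = Z_j and mu_out otherwise.\<close>
definition affiliation_law ::
  "nat \<Rightarrow> nat pmf \<Rightarrow> 'a measure \<Rightarrow> 'a measure \<Rightarrow> ((nat \<times> nat) \<Rightarrow> 'a) measure" where
  "affiliation_law n p mu_in mu_out =
     bind (measure_pmf (Pi_pmf {..<n} 0 (\<lambda>_. p)))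
       (\<lambda>z. PiM (edges n) (\<lambda>e. if z (fst e) = z (snd e) then mu_in else mu_out))"

definition label_swap :: "nat \<Rightarrow> nat pmf \<Rightarrow> nat pmf \<Rightarrow> bool" where
  "label_swap Q p p' \<longleftrightarrow> (\<exists>\<sigma>. \<sigma> permutes {..<Q} \<and> (\<forall>q. pmf p' q = pmf p (\<sigma> q)))"

end

theory Submission
  imports Defs
begin

(* For Q groups consider the one-parameter family of proportions
     pi_theta(q) = (2 + cos ((theta + 2 pi q) / Q)) / (2 Q),   q < Q,
   which lies in the open simplex.  pi_0 and pi_pi are not permutations of each other:
   pi_0 attains the value 3/(2Q) at q = 0, which pi_pi never attains.

   The law of K_n is a mixture, over the labellings z of the n nodes, of product
   measures that depend only on which nodes share a group.  This is unchanged by the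
   cyclic relabelling q |-> q + r (mod Q), so the law only depends on p through the
   cyclically averaged weights  sum_{r<Q} prod_{i<n} p(z_i + r mod Q)  (Section 2).
   For pi_theta this average is a sum of a trigonometric polynomial of degree n < Q
   over Q equally spaced angles; all nonconstant frequencies cancel, so it does not
   depend on theta (Section 1). *)

section \<open>Equally spaced angles kill low-frequency trigonometric polynomials\<close>

lemma exp_progression_sum:
  fixes k :: int
  assumes Q: "Q > 0" and k: "\<bar>k\<bar> < int Q"
  shows "(\<Sum>r<Q. exp (\<i> * (of_int k * complex_of_real ((\<psi> + 2*pi*real r)/real Q))))
         = (if k = 0 then of_nat Q else 0)"
proof -
  define \<omega> where "\<omega> = exp (2 * pi * \<i> * of_int k / of_nat Q)"
  define A where "A = exp (\<i> * of_int k * complex_of_real \<psi> / of_nat Q)"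
  have geometric: "exp (\<i> * (of_int k * complex_of_real ((\<psi> + 2*pi*real r)/real Q))) = A * \<omega> ^ r"
    for r
  proof -
    have "\<i> * (of_int k * complex_of_real ((\<psi> + 2*pi*real r)/real Q))
          = \<i> * of_int k * complex_of_real \<psi> / of_nat Q + of_nat r * (2 * pi * \<i> * of_int k / of_nat Q)"
      using Q by (simp add: field_simps)
    then show ?thesis unfolding A_def \<omega>_def by (simp only: exp_add exp_of_nat_mult)
  qed
  show ?thesis
  proof (cases "k = 0")
    case True
    then show ?thesis by simp
  next
    case False
    have "\<omega> \<noteq> 1"
    proof
      assume "\<omega> = 1"
      then obtain m :: int where "Im (2 * pi * \<i> * of_int k / of_nat Q) = of_int (2 * m) * pi"
        unfolding \<omega>_def exp_eq_1 by blast
      then have "real_of_int k = real_of_int m * real Q" using Q by (simp add: field_simps)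
      then have km: "k = m * int Q" by (metis of_int_eq_iff of_int_mult of_int_of_nat_eq)
      with False have "\<bar>m\<bar> \<ge> 1" by auto
      then have "\<bar>k\<bar> \<ge> int Q"
        unfolding km abs_mult using mult_right_mono[of 1 "\<bar>m\<bar>" "int Q"] by simp
      with k show False by simp
    qed
    moreover have "\<omega> ^ Q = 1"
    proof -
      have "\<omega> ^ Q = exp (of_nat Q * (2 * pi * \<i> * of_int k / of_nat Q))"
        unfolding \<omega>_def by (simp only: flip: exp_of_nat_mult)
      also have "of_nat Q * (2 * pi * \<i> * of_int k / of_nat Q) = complex_of_real (2 * pi * of_int k) * \<i>"
        using Q by simp
      finally show ?thesis by (simp add: exp_eq_1)
    qed
    ultimately have "(\<Sum>r<Q. \<omega> ^ r) = 0" using geometric_sum[of \<omega> Q] by simp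
    then show ?thesis using False by (simp only: geometric sum_distrib_left[symmetric]) simp
  qed
qed

lemma cos_progression_sum:
  assumes "Q \<ge> 2"
  shows "(\<Sum>q<Q. cos ((\<theta> + 2*pi*real q)/real Q)) = 0"
proof -
  have Q: "Q > 0" using assms by simp
  let ?E = "\<lambda>k::int. \<Sum>r<Q. exp (\<i> * (of_int k * complex_of_real ((\<theta> + 2*pi*real r)/real Q)))"
  have cos_exp: "complex_of_real (cos x)
      = (exp (\<i> * (of_int 1 * complex_of_real x)) + exp (\<i> * (of_int (-1) * complex_of_real x))) / 2"
    for x
    by (simp add: cos_of_real [symmetric] cos_exp_eq)
  have "complex_of_real (\<Sum>q<Q. cos ((\<theta> + 2*pi*real q)/real Q)) = (?E 1 + ?E (-1)) / 2"
    by (simp only: of_real_sum cos_exp add_divide_distrib sum.distrib sum_divide_distrib)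
  also have "\<dots> = 0" using exp_progression_sum[OF Q, of 1 \<theta>] exp_progression_sum[OF Q, of "-1" \<theta>] assms
    by simp
  finally show ?thesis by (simp only: of_real_eq_0_iff)
qed

definition wave :: "nat \<Rightarrow> real \<Rightarrow> real" where
  "wave Q x = (2 + cos x) / (2 * real Q)"

lemma wave_pos: "Q > 0 \<Longrightarrow> wave Q x > 0"
proof -
  assume "Q > 0"
  moreover have "0 < 2 + cos x" using cos_ge_minus_one[of x] by linarith
  ultimately show ?thesis unfolding wave_def by simp
qed

text \<open>Fourier coefficients of the shifted wave \<psi> \<mapsto> wave Q (\<psi> + b), indexed by t < 3 for the
  frequencies t - 1 \<in> {-1, 0, 1}.\<close>
definition wave_coeff :: "nat \<Rightarrow> real \<Rightarrow> nat \<Rightarrow> complex" where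
  "wave_coeff Q b t = (if t = 0 then exp (- (\<i> * complex_of_real b)) / (4 * of_nat Q)
                       else if t = 1 then 1 / of_nat Q else exp (\<i> * complex_of_real b) / (4 * of_nat Q))"

lemma wave_fourier:
  assumes Q: "Q > 0"
  shows "complex_of_real (wave Q (\<psi> + b)) =
     (\<Sum>t<3. wave_coeff Q b t * exp (\<i> * (of_int (int t - 1) * complex_of_real \<psi>)))"
proof -
  have cos_exp: "complex_of_real (cos (\<psi> + b)) =
      (exp (\<i> * complex_of_real b) * exp (\<i> * complex_of_real \<psi>) +
       exp (- (\<i> * complex_of_real b)) * exp (- (\<i> * complex_of_real \<psi>))) / 2"
    by (simp add: cos_of_real [symmetric] cos_exp_eq distrib_left algebra_simps flip: exp_add)
  have sum3: "(\<Sum>t<3. f t) = f 0 + f 1 + f 2" for f :: "nat \<Rightarrow> complex"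
    by (simp add: numeral_3_eq_3 numeral_2_eq_2)
  show ?thesis
    unfolding sum3 using Q by (simp add: wave_def cos_exp wave_coeff_def field_simps)
qed

text \<open>A product of n shifted copies of the wave is a trigonometric polynomial of degree n;
  if n < Q, averaging it over Q equally spaced angles keeps only its constant term, whence
  the average does not depend on the offset \<theta> of the angles.\<close>
lemma wave_product_average_complex:
  fixes \<beta> :: "nat \<Rightarrow> real"
  assumes Q: "Q > 0" and n: "n < Q"
  shows "complex_of_real (\<Sum>r<Q. \<Prod>i<n. wave Q ((\<theta> + 2*pi*real r)/real Q + \<beta> i))
     = (\<Sum>\<tau>\<in>PiE {..<n} (\<lambda>_. {..<3}). (\<Prod>i<n. wave_coeff Q (\<beta> i) (\<tau> i)) *
          (if (\<Sum>i<n. int (\<tau> i) - 1) = 0 then of_nat Q else 0))"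
proof -
  let ?T = "PiE {..<n} (\<lambda>_. {..<3::nat})"
  let ?c = "\<lambda>\<tau>. \<Prod>i<n. wave_coeff Q (\<beta> i) (\<tau> i)"
  let ?K = "\<lambda>\<tau>. (\<Sum>i<n. int (\<tau> i) - 1)"
  let ?E = "\<lambda>k r. exp (\<i> * (of_int k * complex_of_real ((\<theta> + 2*pi*real r)/real Q)))"
  have monomial: "(\<Prod>i<n. wave_coeff Q (\<beta> i) (\<tau> i) * ?E (int (\<tau> i) - 1) r) = ?c \<tau> * ?E (?K \<tau>) r"
    for \<tau> r
  proof -
    have "?E (?K \<tau>) r = exp (\<Sum>i<n. \<i> * (of_int (int (\<tau> i) - 1) * complex_of_real ((\<theta> + 2*pi*real r)/real Q)))"
      by (simp only: of_int_sum sum_distrib_left sum_distrib_right)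
    also have "\<dots> = (\<Prod>i<n. ?E (int (\<tau> i) - 1) r)" by (rule exp_sum) simp
    finally show ?thesis by (simp only: prod.distrib)
  qed
  have degree: "\<bar>?K \<tau>\<bar> < int Q" if "\<tau> \<in> ?T" for \<tau>
  proof -
    have "\<bar>?K \<tau>\<bar> \<le> (\<Sum>i<n. \<bar>int (\<tau> i) - 1\<bar>)" by (rule sum_abs)
    also have "\<dots> \<le> (\<Sum>i<n. 1)"
      using that by (intro sum_mono) (drule (1) PiE_mem, auto)
    finally show ?thesis using n by simp
  qed
  have "complex_of_real (\<Sum>r<Q. \<Prod>i<n. wave Q ((\<theta> + 2*pi*real r)/real Q + \<beta> i))
      = (\<Sum>r<Q. \<Prod>i<n. \<Sum>t<3. wave_coeff Q (\<beta> i) t * ?E (int t - 1) r)"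
    by (simp only: of_real_sum of_real_prod wave_fourier[OF Q])
  also have "\<dots> = (\<Sum>r<Q. \<Sum>\<tau>\<in>?T. \<Prod>i<n. wave_coeff Q (\<beta> i) (\<tau> i) * ?E (int (\<tau> i) - 1) r)"
    by (rule sum.cong[OF refl], rule prod_sum_PiE) auto
  also have "\<dots> = (\<Sum>\<tau>\<in>?T. ?c \<tau> * (\<Sum>r<Q. ?E (?K \<tau>) r))"
    by (simp only: monomial sum_distrib_left sum.swap[of _ "{..<Q}"])
  also have "\<dots> = (\<Sum>\<tau>\<in>?T. ?c \<tau> * (if ?K \<tau> = 0 then of_nat Q else 0))"
    by (rule sum.cong[OF refl]) (simp only: exp_progression_sum[OF Q degree])
  finally show ?thesis .
qed

lemma wave_product_average:
  fixes \<beta> :: "nat \<Rightarrow> real"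
  assumes "Q > 0" and "n < Q"
  shows "(\<Sum>r<Q. \<Prod>i<n. wave Q ((\<theta> + 2*pi*real r)/real Q + \<beta> i))
       = (\<Sum>r<Q. \<Prod>i<n. wave Q ((\<theta>' + 2*pi*real r)/real Q + \<beta> i))"
proof -
  have "complex_of_real (\<Sum>r<Q. \<Prod>i<n. wave Q ((\<theta> + 2*pi*real r)/real Q + \<beta> i))
      = complex_of_real (\<Sum>r<Q. \<Prod>i<n. wave Q ((\<theta>' + 2*pi*real r)/real Q + \<beta> i))"
    by (simp only: wave_product_average_complex[OF assms])
  then show ?thesis by (simp only: of_real_eq_iff)
qed

section \<open>The law of K_n only sees cyclically averaged labelling weights\<close>

definition edge_law :: "nat \<Rightarrow> 'a measure \<Rightarrow> 'a measure \<Rightarrow> (nat \<Rightarrow> nat) \<Rightarrow> ((nat \<times> nat) \<Rightarrow> 'a) measure" where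
  "edge_law n mu_in mu_out z = PiM (edges n) (\<lambda>e. if z (fst e) = z (snd e) then mu_in else mu_out)"

definition labellings :: "nat \<Rightarrow> nat \<Rightarrow> (nat \<Rightarrow> nat) set" where
  "labellings n Q = PiE_dflt {..<n} 0 (\<lambda>_. {..<Q})"

definition cyc_shift :: "nat \<Rightarrow> nat \<Rightarrow> nat \<Rightarrow> (nat \<Rightarrow> nat) \<Rightarrow> (nat \<Rightarrow> nat)" where
  "cyc_shift Q n r z = (\<lambda>i. if i < n then (z i + r) mod Q else 0)"

definition cyclic_weight :: "nat \<Rightarrow> nat \<Rightarrow> nat pmf \<Rightarrow> (nat \<Rightarrow> nat) \<Rightarrow> real" where
  "cyclic_weight Q n p z = (\<Sum>r<Q. \<Prod>i<n. pmf p ((z i + r) mod Q))"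

lemma labellings_iff: "z \<in> labellings n Q \<longleftrightarrow> (\<forall>i. (i < n \<longrightarrow> z i < Q) \<and> (\<not> i < n \<longrightarrow> z i = 0))"
  by (auto simp: labellings_def PiE_dflt_def)

lemma edge_law_partition:
  assumes "\<And>i j. i < n \<Longrightarrow> j < n \<Longrightarrow> y i = y j \<longleftrightarrow> z i = z j"
  shows "edge_law n mu_in mu_out y = edge_law n mu_in mu_out z"
  unfolding edge_law_def
proof (rule PiM_cong[OF refl])
  fix e assume "e \<in> edges n"
  then have "fst e < n" "snd e < n" by (auto simp: edges_def)
  then show "(if y (fst e) = y (snd e) then mu_in else mu_out) =
             (if z (fst e) = z (snd e) then mu_in else mu_out)"
    using assms by simp
qed

lemma mod_shift_inverse: "(a::nat) < Q \<Longrightarrow> r \<le> Q \<Longrightarrow> ((a + r) mod Q + (Q - r)) mod Q = a"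
proof -
  assume a: "a < Q" and r: "r \<le> Q"
  have "((a + r) mod Q + (Q - r)) mod Q = (a + r + (Q - r)) mod Q" by (rule mod_add_left_eq)
  also have "a + r + (Q - r) = a + Q" using r by simp
  finally show ?thesis using a by simp
qed

lemma cyc_shift_bij:
  assumes r: "r < Q"
  shows "bij_betw (cyc_shift Q n r) (labellings n Q) (labellings n Q)"
proof (rule bij_betw_byWitness[where f'="cyc_shift Q n (Q - r)"])
  show "\<forall>z\<in>labellings n Q. cyc_shift Q n (Q - r) (cyc_shift Q n r z) = z"
    using r mod_shift_inverse[of _ Q r] by (auto simp: labellings_iff cyc_shift_def fun_eq_iff)
  show "\<forall>z\<in>labellings n Q. cyc_shift Q n r (cyc_shift Q n (Q - r) z) = z"
    using r mod_shift_inverse[of _ Q "Q - r"]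
    by (auto simp: labellings_iff cyc_shift_def fun_eq_iff)
qed (use r in \<open>auto simp: labellings_iff cyc_shift_def\<close>)

text \<open>A cyclic relabelling does not change which nodes share a group, hence not the edge law.\<close>
lemma edge_law_cyc_shift:
  assumes z: "z \<in> labellings n Q" and r: "r < Q"
  shows "edge_law n mu_in mu_out (cyc_shift Q n r z) = edge_law n mu_in mu_out z"
proof (rule edge_law_partition)
  fix i j assume ij: "i < n" "j < n"
  then have zQ: "z i < Q" "z j < Q" using z by (auto simp: labellings_iff)
  have "z i = z j" if "(z i + r) mod Q = (z j + r) mod Q"
    using mod_shift_inverse[OF zQ(1), of r] mod_shift_inverse[OF zQ(2), of r] r that by simp
  then show "cyc_shift Q n r z i = cyc_shift Q n r z j \<longleftrightarrow> z i = z j"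
    using ij by (auto simp: cyc_shift_def)
qed

context
  fixes mu_in mu_out :: "'a measure"
  assumes prob_in: "prob_space mu_in" and prob_out: "prob_space mu_out"
    and sets_in_out: "sets mu_in = sets mu_out"
begin

text \<open>All edge laws are probability measures on one common product space, so they form a
  kernel from any discrete space of labellings.\<close>
lemma sets_edge_law: "sets (edge_law n mu_in mu_out z) = sets (PiM (edges n) (\<lambda>_. mu_in))"
  unfolding edge_law_def by (rule sets_PiM_cong) (auto simp: sets_in_out)

lemma edge_law_kernel:
  "edge_law n mu_in mu_out \<in> measurable (measure_pmf X) (subprob_algebra (PiM (edges n) (\<lambda>_. mu_in)))"
proof -
  have "prob_space (edge_law n mu_in mu_out z)" for z
    unfolding edge_law_def by (rule prob_space_PiM) (auto simp: prob_in prob_out)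
  then show ?thesis
    using sets_edge_law by (auto simp: space_subprob_algebra intro: prob_space_imp_subprob_space)
qed

lemma sets_affiliation_law: "sets (affiliation_law n p mu_in mu_out) = sets (PiM (edges n) (\<lambda>_. mu_in))"
  unfolding affiliation_law_def edge_law_def[symmetric]
  by (rule sets_bind[OF sets_edge_law]) (simp add: space_measure_pmf)

lemma affiliation_law_mixture:
  assumes p: "set_pmf p \<subseteq> {..<Q}" and A: "A \<in> sets (PiM (edges n) (\<lambda>_. mu_in))"
  shows "emeasure (affiliation_law n p mu_in mu_out) A
       = (\<Sum>z\<in>labellings n Q. emeasure (edge_law n mu_in mu_out z) A * ennreal (\<Prod>i<n. pmf p (z i)))"
proof -
  let ?Z = "Pi_pmf {..<n} 0 (\<lambda>_. p)"
  have support: "set_pmf ?Z \<subseteq> labellings n Q"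
  proof -
    have "set_pmf ?Z \<subseteq> PiE_dflt {..<n} 0 (set_pmf \<circ> (\<lambda>_. p))"
      by (rule set_Pi_pmf_subset') simp
    also have "\<dots> \<subseteq> labellings n Q" using p unfolding labellings_def PiE_dflt_def by auto
    finally show ?thesis .
  qed
  have weight: "pmf ?Z z = (\<Prod>i<n. pmf p (z i))" if "z \<in> labellings n Q" for z
    using that by (subst pmf_Pi') (auto simp: labellings_iff)
  have "emeasure (affiliation_law n p mu_in mu_out) A
      = (\<integral>\<^sup>+z. emeasure (edge_law n mu_in mu_out z) A \<partial>measure_pmf ?Z)"
    unfolding affiliation_law_def edge_law_def[symmetric]
    by (rule emeasure_bind[OF _ edge_law_kernel A]) simp
  also have "\<dots> = (\<Sum>z\<in>labellings n Q. emeasure (edge_law n mu_in mu_out z) A * ennreal (pmf ?Z z))"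
    by (rule nn_integral_measure_pmf_support) (use support in \<open>auto simp: labellings_def\<close>)
  also have "\<dots> = (\<Sum>z\<in>labellings n Q. emeasure (edge_law n mu_in mu_out z) A * ennreal (\<Prod>i<n. pmf p (z i)))"
    by (rule sum.cong) (auto simp: weight)
  finally show ?thesis .
qed

text \<open>Averaging the mixture over the Q cyclic relabellings, which permute the labellings and
  leave every edge law unchanged, replaces each weight by its cyclic average.\<close>
lemma affiliation_law_cyclic_average:
  assumes p: "set_pmf p \<subseteq> {..<Q}" and A: "A \<in> sets (PiM (edges n) (\<lambda>_. mu_in))"
  shows "of_nat Q * emeasure (affiliation_law n p mu_in mu_out) A
       = (\<Sum>z\<in>labellings n Q. emeasure (edge_law n mu_in mu_out z) A * ennreal (cyclic_weight Q n p z))"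
proof -
  let ?L = "labellings n Q"
  let ?E = "\<lambda>z. emeasure (edge_law n mu_in mu_out z) A"
  let ?w = "\<lambda>r z. \<Prod>i<n. pmf p ((z i + r) mod Q)"
  have shifted_term: "?E (cyc_shift Q n r z) * ennreal (\<Prod>i<n. pmf p (cyc_shift Q n r z i)) = ?E z * ennreal (?w r z)"
    if "z \<in> ?L" "r < Q" for r z
    using that by (simp add: edge_law_cyc_shift) (simp add: cyc_shift_def)
  have "of_nat Q * emeasure (affiliation_law n p mu_in mu_out) A
      = (\<Sum>r<Q. \<Sum>z\<in>?L. ?E z * ennreal (\<Prod>i<n. pmf p (z i)))"
    by (simp add: affiliation_law_mixture[OF p A])
  also have "\<dots> = (\<Sum>r<Q. \<Sum>z\<in>?L. ?E (cyc_shift Q n r z) * ennreal (\<Prod>i<n. pmf p (cyc_shift Q n r z i)))"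
    by (rule sum.cong[OF refl], rule sum.reindex_bij_betw[symmetric], rule cyc_shift_bij) simp
  also have "\<dots> = (\<Sum>r<Q. \<Sum>z\<in>?L. ?E z * ennreal (?w r z))"
    by (intro sum.cong refl shifted_term) auto
  also have "\<dots> = (\<Sum>z\<in>?L. \<Sum>r<Q. ?E z * ennreal (?w r z))"
    by (rule sum.swap)
  also have "\<dots> = (\<Sum>z\<in>?L. ?E z * ennreal (cyclic_weight Q n p z))"
  proof (rule sum.cong[OF refl])
    fix z
    have "ennreal (cyclic_weight Q n p z) = (\<Sum>r<Q. ennreal (?w r z))"
      unfolding cyclic_weight_def by (rule sum_ennreal[symmetric]) (simp add: prod_nonneg)
    then show "(\<Sum>r<Q. ?E z * ennreal (?w r z)) = ?E z * ennreal (cyclic_weight Q n p z)"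
      by (simp only: sum_distrib_left)
  qed
  finally show ?thesis .
qed

lemma affiliation_law_eq_if_cyclic_weights_eq:
  assumes Q: "Q > 0" and p: "set_pmf p \<subseteq> {..<Q}" and p': "set_pmf p' \<subseteq> {..<Q}"
    and same: "\<And>z. z \<in> labellings n Q \<Longrightarrow> cyclic_weight Q n p z = cyclic_weight Q n p' z"
  shows "affiliation_law n p mu_in mu_out = affiliation_law n p' mu_in mu_out"
proof (rule measure_eqI)
  show "sets (affiliation_law n p mu_in mu_out) = sets (affiliation_law n p' mu_in mu_out)"
    by (simp only: sets_affiliation_law)
  fix A assume "A \<in> sets (affiliation_law n p mu_in mu_out)"
  then have A: "A \<in> sets (PiM (edges n) (\<lambda>_. mu_in))" by (simp only: sets_affiliation_law)
  have "of_nat Q * emeasure (affiliation_law n p mu_in mu_out) A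
      = of_nat Q * emeasure (affiliation_law n p' mu_in mu_out) A"
    by (simp only: affiliation_law_cyclic_average[OF p A] affiliation_law_cyclic_average[OF p' A] same
          cong: sum.cong)
  then show "emeasure (affiliation_law n p mu_in mu_out) A = emeasure (affiliation_law n p' mu_in mu_out) A"
    using Q by (simp add: ennreal_mult_cancel_left)
qed

end

section \<open>The counterexample\<close>

definition wave_mass :: "nat \<Rightarrow> real \<Rightarrow> nat \<Rightarrow> real" where
  "wave_mass Q \<theta> q = (if q < Q then wave Q ((\<theta> + 2*pi*real q)/real Q) else 0)"

definition wave_pmf :: "nat \<Rightarrow> real \<Rightarrow> nat pmf" where
  "wave_pmf Q \<theta> = embed_pmf (wave_mass Q \<theta>)"

lemma wave_mass_nonneg: "Q > 0 \<Longrightarrow> wave_mass Q \<theta> q \<ge> 0"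
  unfolding wave_mass_def using wave_pos[of Q] by (auto intro: less_imp_le)

lemma wave_mass_total:
  assumes Q: "Q \<ge> 2"
  shows "(\<integral>\<^sup>+q. ennreal (wave_mass Q \<theta> q) \<partial>count_space UNIV) = 1"
proof -
  have "(\<Sum>q<Q. wave_mass Q \<theta> q) = (2 * real Q + (\<Sum>q<Q. cos ((\<theta> + 2*pi*real q)/real Q))) / (2 * real Q)"
    by (simp add: wave_mass_def wave_def sum_divide_distrib[symmetric] sum.distrib)
  also have "\<dots> = 1" using Q by (simp add: cos_progression_sum)
  finally have sum1: "(\<Sum>q<Q. wave_mass Q \<theta> q) = 1" .
  have "(\<integral>\<^sup>+q. ennreal (wave_mass Q \<theta> q) \<partial>count_space UNIV) = (\<Sum>q<Q. ennreal (wave_mass Q \<theta> q))"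
    by (rule nn_integral_count_space') (auto simp: wave_mass_def)
  also have "\<dots> = ennreal (\<Sum>q<Q. wave_mass Q \<theta> q)"
    using Q by (intro sum_ennreal wave_mass_nonneg) auto
  finally show ?thesis using sum1 by simp
qed

lemma pmf_wave_pmf: "Q \<ge> 2 \<Longrightarrow> pmf (wave_pmf Q \<theta>) q = wave_mass Q \<theta> q"
  unfolding wave_pmf_def by (rule pmf_embed_pmf[OF wave_mass_nonneg wave_mass_total]) auto

lemma set_wave_pmf: "Q \<ge> 2 \<Longrightarrow> set_pmf (wave_pmf Q \<theta>) \<subseteq> {..<Q}"
  unfolding wave_pmf_def by (subst set_embed_pmf[OF wave_mass_nonneg wave_mass_total])
    (auto simp: wave_mass_def)

lemma wave_pmf_open_simplex: "Q \<ge> 2 \<Longrightarrow> open_simplex Q (wave_pmf Q \<theta>)"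
  unfolding open_simplex_def using set_wave_pmf[of Q \<theta>]
  by (auto simp: pmf_wave_pmf wave_mass_def intro: wave_pos)

lemma cos_minus_2pi_nat: "cos (x - 2 * pi * real m) = cos x"
proof -
  have "cos (x - 2 * pi * real m) = cos x * cos ((2 * pi) * of_int (int m)) + sin x * sin ((2 * pi) * of_int (int m))"
    by (simp add: cos_diff)
  then show ?thesis using cos_int_2pin[of "int m"] sin_int_2pin[of "int m"] by simp
qed

text \<open>Relabelling q \<mapsto> q + r (mod Q) rotates all the angles by 2 pi r / Q.\<close>
lemma wave_mass_shift:
  assumes "Q > 0" "a < Q"
  shows "wave_mass Q \<theta> ((a + r) mod Q) = wave Q ((\<theta> + 2*pi*real r)/real Q + 2*pi*real a/real Q)"
proof -
  define m where "m = (a + r) div Q"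
  have "a + r = m * Q + (a + r) mod Q" unfolding m_def by simp
  then have "real a + real r = real m * real Q + real ((a + r) mod Q)"
    by (metis of_nat_add of_nat_mult)
  then have mod_eq: "real ((a + r) mod Q) = real a + real r - real m * real Q" by linarith
  then have "(\<theta> + 2*pi*real ((a + r) mod Q))/real Q
      = ((\<theta> + 2*pi*real r)/real Q + 2*pi*real a/real Q) - 2 * pi * real m"
    unfolding mod_eq using assms by (simp add: field_simps)
  then show ?thesis using assms by (simp add: wave_mass_def wave_def cos_minus_2pi_nat)
qed

lemma cyclic_weight_wave_pmf:
  assumes Q: "Q \<ge> 2" and n: "n < Q" and z: "z \<in> labellings n Q"
  shows "cyclic_weight Q n (wave_pmf Q \<theta>) z = cyclic_weight Q n (wave_pmf Q \<theta>') z"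
proof -
  have rotated: "cyclic_weight Q n (wave_pmf Q t) z
      = (\<Sum>r<Q. \<Prod>i<n. wave Q ((t + 2*pi*real r)/real Q + 2*pi*real (z i)/real Q))" for t
    unfolding cyclic_weight_def using Q z
    by (intro sum.cong prod.cong refl) (auto simp: pmf_wave_pmf wave_mass_shift labellings_iff)
  show ?thesis unfolding rotated using Q n by (intro wave_product_average) auto
qed

text \<open>pi_pi is not a relabelling of pi_0: the value pi_0(0) = 3/(2Q) would require
  cos ((pi + 2 pi q)/Q) = 1, i.e. an odd number 1 + 2q divisible by the even 2Q.\<close>
lemma wave_pmf_not_label_swap:
  assumes Q: "Q \<ge> 2"
  shows "\<not> label_swap Q (wave_pmf Q 0) (wave_pmf Q pi)"
proof
  assume "label_swap Q (wave_pmf Q 0) (wave_pmf Q pi)"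
  then obtain \<sigma> where \<sigma>: "\<sigma> permutes {..<Q}"
    and eq: "\<And>q. pmf (wave_pmf Q pi) q = pmf (wave_pmf Q 0) (\<sigma> q)"
    unfolding label_swap_def by blast
  obtain q where q: "\<sigma> q = 0" using \<sigma> unfolding permutes_def by metis
  have "q < Q"
  proof (rule ccontr)
    assume "\<not> q < Q"
    then have "\<sigma> q = q" using \<sigma> by (auto simp: permutes_def)
    with q Q \<open>\<not> q < Q\<close> show False by simp
  qed
  then have "cos ((pi + 2*pi*real q)/real Q) = 1"
    using eq[of q] q Q by (simp add: pmf_wave_pmf wave_mass_def wave_def)
  then obtain m :: int where "(pi + 2*pi*real q)/real Q = of_int m * 2 * pi"
    by (auto simp: cos_one_2pi_int)
  then have "pi * (1 + 2 * real q) = pi * (2 * of_int m * real Q)" using Q by (simp add: field_simps)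
  then have "real_of_int (1 + 2 * int q) = real_of_int (2 * m * int Q)" by simp
  then have "1 + 2 * int q = 2 * m * int Q" by (simp only: of_int_eq_iff)
  then have "even (1 + 2 * int q)" by simp
  then show False by simp
qed

theorem proposition3:
  fixes Q n :: nat and mu_in mu_out :: "'a measure"
  assumes "Q \<ge> 2" and "n < Q"
    and "prob_space mu_in" and "prob_space mu_out"
    and "sets mu_in = sets mu_out"
  shows "\<exists>p p'. open_simplex Q p \<and> open_simplex Q p' \<and> \<not> label_swap Q p p' \<and>
           affiliation_law n p mu_in mu_out = affiliation_law n p' mu_in mu_out"
proof (intro exI conjI)
  show "open_simplex Q (wave_pmf Q 0)" "open_simplex Q (wave_pmf Q pi)"
    using assms(1) by (rule wave_pmf_open_simplex)+
  show "\<not> label_swap Q (wave_pmf Q 0) (wave_pmf Q pi)"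
    using assms(1) by (rule wave_pmf_not_label_swap)
  show "affiliation_law n (wave_pmf Q 0) mu_in mu_out = affiliation_law n (wave_pmf Q pi) mu_in mu_out"
    using assms(1) by (intro affiliation_law_eq_if_cyclic_weights_eq[OF assms(3-5), where Q = Q]
        set_wave_pmf cyclic_weight_wave_pmf[OF assms(1,2)]) auto
qed

end
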